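(* Let $C$ be a quaternary Hermitian LCD $[n,k]$ code and let $G$ be a generator matrix of $C$ such that $G\overline{G}^T=I_k$. Let $l_i$ denote the $i$-th column of $G$. Then the shortened code $C_i$ is a Hermitian LCD code if and only if $\mathrm{wt}(l_i)$ is odd.
   Context: A quaternary $[n,k]$ code is a $k$-dimensional subspace $C$ of $\mathbb{F}_4^n$; a generator matrix of it is a matrix whose rows form a basis of it. Here $i$ is a coordinate position, $1\le i\le n$. The weight $\mathrm{wt}(v)$ of a vector $v$ is its number of nonzero coordinates. For $a\in\mathbb{F}_4$, $\overline{a}=a^2$; for a matrix $M$, $\overline{M}$ is the entrywise conjugate and $M^T$ the transpose. $I_k$ is the identity matrix of order $k$. The Hermitian inner product of $u,v\in\mathbb{F}_4^m$ is $(u,v)_h=\sum_{j=1}^m u_j\overline{v_j}$, and for a code $C$ of length $m$, $C^{\perp h}=\{u\in\mathbb{F}_4^m\mid (u,v)_h=0\text{ for all }v\in C\}$. A code $C$ is a Hermitian LCD code if $C\cap C^{\perp h}=\{0\}$. The shortened code $C_i$ is the code of length $n-1$ obtained by deleting the $i$-th coordinate from every codeword of the subcode $\{(c_1,\dots,c_n)\in C\mid c_i=0\}$.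
   Formalization: The formal theorem adds the assumption that the column l_i is nonzero; if l_i = 0 then C_i is always Hermitian LCD although wt(l_i) = 0 is even, so the claim as stated fails (e.g. G = (1 0), i = 2). *)

theory Defs
  imports "Jordan_Normal_Form.VS_Connect"
begin

(* The field F_4 is represented by an arbitrary type 'a :: field with four elements;
   vectors of F_4^n are the elements of carrier_vec n, so that coordinates are numbered 0, ..., n-1. *)

definition linear_code :: "nat \<Rightarrow> nat \<Rightarrow> 'a::field vec set \<Rightarrow> bool" where
  "linear_code n k C \<longleftrightarrow>
     VectorSpace.subspace class_ring C (module_vec TYPE('a) n) \<and>
     vectorspace.dim class_ring (module_vec TYPE('a) n\<lparr>carrier := C\<rparr>) = k"

(* Distinctness is needed because basis only sees the set of rows. *)
definition generator_matrix :: "nat \<Rightarrow> nat \<Rightarrow> 'a::field vec set \<Rightarrow> 'a mat \<Rightarrow> bool" where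
  "generator_matrix n k C G \<longleftrightarrow>
     G \<in> carrier_mat k n \<and> distinct (rows G) \<and>
     vectorspace.basis class_ring (module_vec TYPE('a) n\<lparr>carrier := C\<rparr>) (set (rows G))"

definition wt :: "'a::zero vec \<Rightarrow> nat" where
  "wt v = card {j. j < dim_vec v \<and> v $ j \<noteq> 0}"

(* The Frobenius automorphism of F_4. The library class of conjugatable rings is not used: it would
   leave the conjugation of 'a unspecified. *)
definition conj4 :: "'a::field \<Rightarrow> 'a" where
  "conj4 a = a ^ 2"

definition hermitian_inner :: "'a::field vec \<Rightarrow> 'a vec \<Rightarrow> 'a" where
  "hermitian_inner u v = u \<bullet> map_vec conj4 v"

definition hermitian_dual :: "nat \<Rightarrow> 'a::field vec set \<Rightarrow> 'a vec set" where
  "hermitian_dual m C = {u \<in> carrier_vec m. \<forall>v\<in>C. hermitian_inner u v = 0}"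

definition hermitian_lcd_code :: "nat \<Rightarrow> 'a::field vec set \<Rightarrow> bool" where
  "hermitian_lcd_code m C \<longleftrightarrow>
     (\<exists>k. linear_code m k C) \<and> C \<inter> hermitian_dual m C = {0\<^sub>v m}"

(* insert_index i is the increasing enumeration of the indices other than i. *)
definition delete_coord :: "nat \<Rightarrow> 'a vec \<Rightarrow> 'a vec" where
  "delete_coord i v = vec (dim_vec v - 1) (\<lambda>j. v $ insert_index i j)"

definition shortened_code :: "nat \<Rightarrow> 'a::zero vec set \<Rightarrow> 'a vec set" where
  "shortened_code i C = delete_coord i ` {c \<in> C. c $ i = 0}"

end

theory Submission
  imports Defs
begin

text \<open>Let a be the codeword with coefficient vector the conjugate of the i-th column. Since the
  rows of G are orthonormal, every codeword c satisfies (c, a) = c_i. So the subcode of C with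
  vanishing i-th coordinate, which is isometric to the shortened code, is the orthogonal complement
  of a in C, and its hull is nonzero iff a itself has norm 0. The norm of a is a_i, the sum of the
  third powers of the entries of the column, i.e. the weight of the column modulo 2.\<close>

section \<open>Arithmetic of the field with four elements and its conjugation\<close>

lemma F4_two:
  assumes "card (UNIV :: 'a::field set) = 4"
  shows "(2 :: 'a) = 0"
proof -
  \<comment> \<open>Translation by 1 permutes the field; cancelling the common sum leaves four ones
    adding up to 0.\<close>
  have "(\<Sum>x\<in>(UNIV::'a set). x + 1) = (\<Sum>x\<in>UNIV. x)"
    by (rule sum.reindex_bij_witness[of _ "\<lambda>x. x - 1" "\<lambda>x. x + 1"]) auto
  then have "(4 :: 'a) = 0"
    by (simp add: sum.distrib assms)
  then have "(2 :: 'a) * 2 = 0" by simp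
  then show ?thesis by (auto simp only: mult_eq_0_iff)
qed

text \<open>Multiplication by \<open>a\<close> permutes the three nonzero elements, so their nonzero
  product absorbs the factor \<open>a ^ 3\<close>.\<close>

lemma F4_cube:
  fixes a :: "'a::field"
  assumes F4: "card (UNIV :: 'a set) = 4" and a: "a \<noteq> 0"
  shows "a ^ 3 = 1"
proof -
  have fin: "finite (UNIV :: 'a set)" by (rule card_ge_0_finite) (simp add: F4)
  have "(\<Prod>x\<in>UNIV - {0::'a}. a * x) = (\<Prod>x\<in>UNIV - {0}. x)"
    by (rule prod.reindex_bij_witness[of _ "\<lambda>x. x / a" "\<lambda>x. a * x"]) (use a in auto)
  moreover have "card (UNIV - {0::'a}) = 3" by (simp add: F4 card_Diff_singleton)
  moreover have "(\<Prod>x\<in>UNIV - {0::'a}. x) \<noteq> 0" using fin by (simp add: prod_zero_iff)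
  ultimately show ?thesis by (simp add: prod.distrib)
qed

lemma F4_of_nat_eq_0_iff:
  assumes "card (UNIV :: 'a::field set) = 4"
  shows "of_nat m = (0::'a) \<longleftrightarrow> even m"
proof (cases "even m")
  case True
  then show ?thesis using F4_two[OF assms] by (auto elim!: evenE)
next
  case False
  then show ?thesis using F4_two[OF assms] by (auto elim!: oddE)
qed

lemma conj4_simps [simp]: "conj4 0 = 0" "conj4 (x * y) = conj4 x * conj4 y"
  by (simp_all add: conj4_def power_mult_distrib)

lemma conj4_eq_0_iff [simp]: "conj4 x = 0 \<longleftrightarrow> x = 0"
  by (simp add: conj4_def)

lemma conj4_add:
  fixes x y :: "'a::field"
  assumes "card (UNIV :: 'a set) = 4"
  shows "conj4 (x + y) = conj4 x + conj4 y"
  using F4_two[OF assms] by (simp add: conj4_def power2_sum)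

lemma conj4_sum:
  fixes f :: "'b \<Rightarrow> 'a::field"
  assumes "card (UNIV :: 'a set) = 4"
  shows "conj4 (sum f A) = (\<Sum>x\<in>A. conj4 (f x))"
  by (induction A rule: infinite_finite_induct) (simp_all add: conj4_add[OF assms])

lemma conj4_conj4:
  fixes x :: "'a::field"
  assumes "card (UNIV :: 'a set) = 4"
  shows "conj4 (conj4 x) = x"
proof (cases "x = 0")
  case False
  have "x ^ 4 = x * x ^ 3" by (simp add: eval_nat_numeral)
  also have "\<dots> = x" by (simp add: F4_cube[OF assms False])
  finally show ?thesis by (simp add: conj4_def flip: power_mult)
qed simp

text \<open>A nonzero entry \<open>x\<close> contributes \<open>x * x ^ 2 = 1\<close>, so the
  Hermitian norm of a vector counts its support inside the field.\<close>

lemma F4_norm_sum: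
  fixes l :: "'a::field vec"
  assumes "card (UNIV :: 'a set) = 4"
  shows "(\<Sum>j<dim_vec l. l $ j * conj4 (l $ j)) = of_nat (wt l)"
proof -
  have "(\<Sum>j<dim_vec l. l $ j * conj4 (l $ j)) = (\<Sum>j<dim_vec l. if l $ j \<noteq> 0 then 1 else 0)"
    by (rule sum.cong)
      (use F4_cube[OF assms] in \<open>auto simp: conj4_def power2_eq_square power3_eq_cube mult.assoc\<close>)
  also have "\<dots> = of_nat (card {j \<in> {..<dim_vec l}. l $ j \<noteq> 0})"
    by (simp add: sum.If_cases Int_def)
  finally show ?thesis by (simp add: wt_def)
qed

section \<open>The Hermitian inner product\<close>

lemma hermitian_inner_sum:
  assumes "v \<in> carrier_vec n"
  shows "hermitian_inner u v = (\<Sum>j<n. u $ j * conj4 (v $ j))"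
  using assms by (auto simp: hermitian_inner_def scalar_prod_def lessThan_atLeast0 intro!: sum.cong)

lemma hermitian_inner_commute:
  fixes u v :: "'a::field vec"
  assumes "card (UNIV :: 'a set) = 4" "u \<in> carrier_vec n" "v \<in> carrier_vec n"
  shows "hermitian_inner v u = conj4 (hermitian_inner u v)"
  using assms by (simp add: hermitian_inner_sum conj4_sum conj4_conj4 mult.commute)

lemma hermitian_inner_add_smult_right:
  fixes u v w :: "'a::field vec"
  assumes "card (UNIV :: 'a set) = 4" "v \<in> carrier_vec n" "w \<in> carrier_vec n"
  shows "hermitian_inner u (v + b \<cdot>\<^sub>v w) = hermitian_inner u v + conj4 b * hermitian_inner u w"
  using assms(2,3) by (simp add: hermitian_inner_sum[of _ n] conj4_add[OF assms(1)] distrib_left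
      sum.distrib sum_distrib_left mult.left_commute)

section \<open>Linear codes as closed sets of vectors, and their generator matrices\<close>

definition is_code :: "nat \<Rightarrow> 'a::field vec set \<Rightarrow> bool" where
  "is_code n C \<longleftrightarrow> C \<subseteq> carrier_vec n \<and> 0\<^sub>v n \<in> C \<and> (\<forall>u\<in>C. \<forall>v\<in>C. u + v \<in> C) \<and> (\<forall>b. \<forall>u\<in>C. b \<cdot>\<^sub>v u \<in> C)"

lemma submodule_iff_is_code:
  "submodule class_ring C (module_vec TYPE('a) n) \<longleftrightarrow> is_code n (C :: 'a::field vec set)"
proof -
  interpret vec_space "TYPE('a)" n .
  show ?thesis
    by (auto simp: submodule_def is_code_def module_axioms class_ring_simps)
qed

text \<open>The value of \<open>dim\<close> always serves as the witness \<open>k\<close>, so the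
  subspace condition remains.\<close>

lemma linear_code_iff_is_code:
  "(\<exists>k. linear_code n k C) \<longleftrightarrow> is_code n (C :: 'a::field vec set)"
proof -
  interpret vec_space "TYPE('a)" n .
  show ?thesis
    by (auto simp: linear_code_def VectorSpace.subspace_def vectorspace_axioms submodule_iff_is_code)
qed

lemma generator_matrix_codewords:
  fixes C :: "'a::field vec set"
  assumes C: "is_code n C" and G: "generator_matrix n k C G"
  shows "C = (\<lambda>y. transpose_mat G *\<^sub>v y) ` carrier_vec k"
proof -
  interpret vec_space "TYPE('a)" n .
  have sub: "submodule class_ring C V" using C by (simp add: submodule_iff_is_code)
  interpret W: vectorspace class_ring "V\<lparr>carrier := C\<rparr>"
    using sub by (auto intro!: subspace_is_vs simp: VectorSpace.subspace_def vectorspace_axioms)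
  have carr: "G \<in> carrier_mat k n" and rows: "set (rows G) \<subseteq> C" "W.span (set (rows G)) = C"
    using G by (auto simp: generator_matrix_def W.basis_def)
  \<comment> \<open>The basis property speaks of the span computed inside \<open>C\<close>;
    \<open>span_li_not_depend\<close> identifies it with the span in the ambient space, where it is
    the row space.\<close>
  have "C = row_space G"
    using rows span_li_not_depend(1)[OF rows(1) sub] by (simp add: row_space_def)
  also have "\<dots> = (\<lambda>y. transpose_mat G *\<^sub>v y) ` carrier_vec k"
    using carr by (subst row_space_eq[OF carr]) auto
  finally show ?thesis .
qed

section \<open>Orthonormal rows and the codeword that represents a coordinate\<close>

lemma orthonormal_rows_scalar_prod:
  fixes G :: "'a::field mat"
  assumes G: "G \<in> carrier_mat k n" and y: "y \<in> carrier_vec k" and l: "l \<in> carrier_vec k"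
    and orth: "G * transpose_mat (map_mat conj4 G) = 1\<^sub>m k"
  shows "(transpose_mat G *\<^sub>v y) \<bullet> (transpose_mat (map_mat conj4 G) *\<^sub>v l) = y \<bullet> l"
proof -
  \<comment> \<open>Moving \<open>G\<close> to the other side by adjointness creates the product
    that \<open>orth\<close> turns into the identity.\<close>
  have "(transpose_mat G *\<^sub>v y) \<bullet> (transpose_mat (map_mat conj4 G) *\<^sub>v l)
      = y \<bullet> (G *\<^sub>v (transpose_mat (map_mat conj4 G) *\<^sub>v l))"
    using G y l by (intro transpose_vec_mult_scalar) auto
  also have "\<dots> = y \<bullet> ((G * transpose_mat (map_mat conj4 G)) *\<^sub>v l)"
    using G l by (subst assoc_mult_mat_vec) auto
  finally show ?thesis using l by (simp add: orth)
qed

text \<open>Conjugation is an involutive automorphism: it cancels on \<open>l\<close> and passes to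
  \<open>G\<close>, giving the second factor of \<open>orthonormal_rows_scalar_prod\<close>.\<close>

lemma conj4_transpose_mult_vec:
  fixes G :: "'a::field mat"
  assumes F4: "card (UNIV :: 'a set) = 4" and G: "G \<in> carrier_mat k n" and l: "l \<in> carrier_vec k"
  shows "map_vec conj4 (transpose_mat G *\<^sub>v map_vec conj4 l) = transpose_mat (map_mat conj4 G) *\<^sub>v l"
  using G l by (intro eq_vecI)
    (auto simp: scalar_prod_def conj4_sum[OF F4] conj4_conj4[OF F4])

lemma coordinate_representer:
  fixes G :: "'a::field mat"
  assumes F4: "card (UNIV :: 'a set) = 4"
    and code: "is_code n C" and gen: "generator_matrix n k C G"
    and orth: "G * transpose_mat (map_mat conj4 G) = 1\<^sub>m k"
    and i: "i < n"
  obtains a where "a \<in> C" "\<And>c. c \<in> C \<Longrightarrow> hermitian_inner c a = c $ i"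
    "a $ i = of_nat (wt (col G i))"
proof
  have G: "G \<in> carrier_mat k n" using gen by (simp add: generator_matrix_def)
  then have l: "col G i \<in> carrier_vec k" by auto
  have coord: "(transpose_mat G *\<^sub>v y) $ i = col G i \<bullet> y" for y using G i by simp
  \<comment> \<open>The form conjugates its second argument, so the column enters conjugated;
    pairing the encoding of \<open>y\<close> with \<open>a\<close> then gives
    \<open>y \<bullet> col G i\<close>, its i-th coordinate.\<close>
  define a where "a = transpose_mat G *\<^sub>v map_vec conj4 (col G i)"
  show "a \<in> C" using l by (auto simp: a_def generator_matrix_codewords[OF code gen])
  show "hermitian_inner c a = c $ i" if cC: "c \<in> C" for c
  proof -
    obtain y where y: "y \<in> carrier_vec k" and c: "c = transpose_mat G *\<^sub>v y"
      using cC generator_matrix_codewords[OF code gen] by blast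
    have "hermitian_inner c a = y \<bullet> col G i"
      by (simp add: hermitian_inner_def a_def c conj4_transpose_mult_vec[OF F4 G l]
          orthonormal_rows_scalar_prod[OF G y l orth])
    then show ?thesis by (simp add: c coord comm_scalar_prod[OF y l])
  qed
  show "a $ i = of_nat (wt (col G i))"
    unfolding a_def coord F4_norm_sum[OF F4, symmetric]
    by (auto simp: scalar_prod_def lessThan_atLeast0 intro!: sum.cong)
qed

text \<open>The zero vector always lies in the hull, so only the inclusion of the hull in the zero
  space has to be tested.\<close>

lemma hermitian_lcd_code_iff:
  fixes C :: "'a::field vec set"
  assumes "is_code n C"
  shows "hermitian_lcd_code n C \<longleftrightarrow> (\<forall>u\<in>C. (\<forall>v\<in>C. hermitian_inner u v = 0) \<longrightarrow> u = 0\<^sub>v n)"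
proof -
  have "hermitian_inner (0\<^sub>v n) v = 0" if "v \<in> C" for v
    using assms that by (auto simp: is_code_def hermitian_inner_sum[of v n] subset_iff)
  then show ?thesis
    using assms unfolding hermitian_lcd_code_def linear_code_iff_is_code hermitian_dual_def
    by (auto simp: is_code_def subset_iff)
qed

section \<open>Deleting a coordinate, and shortening\<close>

lemma delete_coord_carrier: "v \<in> carrier_vec n \<Longrightarrow> delete_coord i v \<in> carrier_vec (n - 1)"
  by (simp add: delete_coord_def)

lemma insert_index_bij:
  assumes "i < n"
  shows "bij_betw (insert_index i) {..<n - 1} ({..<n} - {i})"
proof -
  obtain m where m: "n = Suc m" using assms by (cases n) auto
  show ?thesis
    using assms insert_index_image[of i m] insert_index_inj_on[of i "{..<m}"]
    by (simp add: m bij_betw_def lessThan_atLeast0)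
qed

lemma delete_coord_nth:
  assumes "v \<in> carrier_vec n" "j < n - 1"
  shows "delete_coord i v $ j = v $ insert_index i j"
  using assms by (simp add: delete_coord_def)

lemma insert_index_less: "i < n \<Longrightarrow> j < n - 1 \<Longrightarrow> insert_index i j < n"
  by (auto simp: insert_index_def)

text \<open>The only lost summand contains the factor \<open>u $ i = 0\<close>. Deletion is thus an
  isometry on the subcode vanishing at \<open>i\<close>.\<close>

lemma hermitian_inner_delete_coord:
  assumes u: "u \<in> carrier_vec n" and v: "v \<in> carrier_vec n" and i: "i < n" and "u $ i = 0"
  shows "hermitian_inner (delete_coord i u) (delete_coord i v) = hermitian_inner u v"
proof -
  have "hermitian_inner (delete_coord i u) (delete_coord i v)
      = (\<Sum>j<n - 1. u $ insert_index i j * conj4 (v $ insert_index i j))"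
    using u v by (simp add: hermitian_inner_sum[OF delete_coord_carrier[OF v]] delete_coord_nth)
  also have "\<dots> = (\<Sum>j\<in>{..<n} - {i}. u $ j * conj4 (v $ j))"
    by (rule sum.reindex_bij_betw[OF insert_index_bij[OF i]])
  also have "\<dots> = (\<Sum>j<n. u $ j * conj4 (v $ j))"
    using i \<open>u $ i = 0\<close> by (simp add: sum.remove[of "{..<n}" i])
  finally show ?thesis by (simp add: hermitian_inner_sum[OF v])
qed

text \<open>Supplies injectivity of deletion on that subcode: the lost coordinate is known to be 0,
  and \<open>insert_index i\<close> reaches all the others.\<close>

lemma delete_coord_eq_0_iff:
  assumes u: "u \<in> carrier_vec n" and i: "i < n" and ui: "u $ i = 0"
  shows "delete_coord i u = 0\<^sub>v (n - 1) \<longleftrightarrow> u = 0\<^sub>v n"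
proof
  assume *: "delete_coord i u = 0\<^sub>v (n - 1)"
  have "u $ j = 0" if j: "j < n" for j
  proof (cases "j = i")
    case False
    then have "j \<in> insert_index i ` {..<n - 1}"
      using j insert_index_bij[OF i] by (simp add: bij_betw_def)
    then obtain j' where "j' < n - 1" "j = insert_index i j'" by auto
    then show ?thesis using * delete_coord_nth[OF u, of j' i] by simp
  qed (simp add: ui)
  then show "u = 0\<^sub>v n" using u by (intro eq_vecI) auto
next
  assume "u = 0\<^sub>v n"
  then show "delete_coord i u = 0\<^sub>v (n - 1)"
    using i by (intro eq_vecI) (auto simp: delete_coord_def insert_index_less)
qed

lemma is_code_shortened_code:
  assumes C: "is_code n C" and i: "i < n"
  shows "is_code (n - 1) (shortened_code i C)"
proof -
  have carr: "C \<subseteq> carrier_vec n" using C by (simp add: is_code_def)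
  have zero: "delete_coord i (0\<^sub>v n) = 0\<^sub>v (n - 1)"
    using i by (subst delete_coord_eq_0_iff[of _ n]) auto
  have dim: "dim_vec u = n" if "u \<in> C" for u
    using that carr by auto
  have add: "delete_coord i u + delete_coord i v = delete_coord i (u + v)"
    if "u \<in> C" "v \<in> C" for u v
    by (intro eq_vecI) (auto simp: delete_coord_def insert_index_less i dim that)
  have smult: "b \<cdot>\<^sub>v delete_coord i u = delete_coord i (b \<cdot>\<^sub>v u)" if "u \<in> C" for b u
    by (intro eq_vecI) (auto simp: delete_coord_def insert_index_less i dim that)
  let ?C0 = "{c \<in> C. c $ i = 0}"
  have z: "0\<^sub>v n \<in> ?C0" using C i by (simp add: is_code_def)
  have a: "u + v \<in> ?C0" if "u \<in> ?C0" "v \<in> ?C0" for u v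
    using C i that carr by (auto simp: is_code_def subset_iff)
  have s: "b \<cdot>\<^sub>v u \<in> ?C0" if "u \<in> ?C0" for b u
    using C i that carr by (auto simp: is_code_def subset_iff)
  have "shortened_code i C \<subseteq> carrier_vec (n - 1)"
    unfolding shortened_code_def using carr delete_coord_carrier by blast
  moreover have "0\<^sub>v (n - 1) \<in> shortened_code i C"
    unfolding shortened_code_def using z zero by (metis (no_types, lifting) image_eqI)
  moreover have "x + y \<in> shortened_code i C"
    if "x \<in> shortened_code i C" "y \<in> shortened_code i C" for x y
    using that a add unfolding shortened_code_def by fastforce
  moreover have "b \<cdot>\<^sub>v x \<in> shortened_code i C" if "x \<in> shortened_code i C" for b x
    using that s smult unfolding shortened_code_def by fastforce
  ultimately show ?thesis by (auto simp: is_code_def)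
qed

text \<open>Since deletion is an injective isometry on the subcode vanishing at \<open>i\<close>,
  the hull can be tested there, with vectors of the original length.\<close>

lemma hermitian_lcd_shortened_code_iff:
  assumes C: "is_code n C" and i: "i < n"
  shows "hermitian_lcd_code (n - 1) (shortened_code i C) \<longleftrightarrow>
    (\<forall>u\<in>C. u $ i = 0 \<and> (\<forall>v\<in>C. v $ i = 0 \<longrightarrow> hermitian_inner u v = 0) \<longrightarrow> u = 0\<^sub>v n)"
proof -
  let ?C0 = "{c \<in> C. c $ i = 0}"
  have carr: "u \<in> carrier_vec n" if "u \<in> ?C0" for u
    using C that by (auto simp: is_code_def)
  have "hermitian_lcd_code (n - 1) (shortened_code i C) \<longleftrightarrow>
      (\<forall>u\<in>?C0. (\<forall>v\<in>?C0. hermitian_inner (delete_coord i u) (delete_coord i v) = 0) \<longrightarrow>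
        delete_coord i u = 0\<^sub>v (n - 1))"
    unfolding hermitian_lcd_code_iff[OF is_code_shortened_code[OF C i]]
    unfolding shortened_code_def by blast
  also have "\<dots> \<longleftrightarrow> (\<forall>u\<in>?C0. (\<forall>v\<in>?C0. hermitian_inner u v = 0) \<longrightarrow> u = 0\<^sub>v n)"
    \<comment> \<open>Removing \<open>One_nat_def\<close> keeps \<open>n - 1\<close> in the form in
      which the rewrite rules mention it.\<close>
    by (intro ball_cong imp_cong refl)
      (use i in \<open>simp_all add: carr hermitian_inner_delete_coord[of _ n]
        delete_coord_eq_0_iff[of _ n] del: One_nat_def\<close>)
  finally show ?thesis by auto
qed

text \<open>By \<open>rep\<close>, the subcode vanishing at \<open>i\<close> is the complement of
  \<open>a\<close> in \<open>C\<close>. If \<open>a $ i = 0\<close>, then \<open>a\<close> lies in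
  its hull; otherwise \<open>C\<close> is the orthogonal sum of the subcode and the line of
  \<open>a\<close>, so a hull vector of the subcode is orthogonal to all of \<open>C\<close>. For
  \<open>a = 0\<close> the equivalence would fail: every codeword would vanish at \<open>i\<close>,
  and shortening would preserve the LCD property.\<close>

lemma representer_nonzero_lcd_shortened:
  fixes C :: "'a::field vec set"
  assumes F4: "card (UNIV :: 'a set) = 4" and C: "is_code n C" and lcd: "hermitian_lcd_code n C"
    and i: "i < n" and a: "a \<in> C" "a \<noteq> 0\<^sub>v n"
    and rep: "\<And>c. c \<in> C \<Longrightarrow> hermitian_inner c a = c $ i"
  shows "hermitian_lcd_code (n - 1) (shortened_code i C) \<longleftrightarrow> a $ i \<noteq> 0"
proof -
  have carr: "C \<subseteq> carrier_vec n" using C by (simp add: is_code_def)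
  show ?thesis
  proof
    assume short: "hermitian_lcd_code (n - 1) (shortened_code i C)"
    have "hermitian_inner a v = 0" if "v \<in> C" "v $ i = 0" for v
      using that a carr rep[of v] hermitian_inner_commute[OF F4, of v n a] by auto
    then show "a $ i \<noteq> 0"
      using short a unfolding hermitian_lcd_shortened_code_iff[OF C i] by blast
  next
    assume ai: "a $ i \<noteq> 0"
    show "hermitian_lcd_code (n - 1) (shortened_code i C)"
      unfolding hermitian_lcd_shortened_code_iff[OF C i]
    proof (intro ballI impI)
      fix u assume u: "u \<in> C" and orth: "u $ i = 0 \<and> (\<forall>v\<in>C. v $ i = 0 \<longrightarrow> hermitian_inner u v = 0)"
      have "hermitian_inner u v = 0" if v: "v \<in> C" for v
      proof -
        \<comment> \<open>The multiple of \<open>a\<close> that cancels the i-th coordinate of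
          \<open>v\<close>; adding it leaves the product with \<open>u\<close> unchanged, because
          \<open>u\<close> has product \<open>u $ i = 0\<close> with \<open>a\<close>.\<close>
        define b where "b = - (v $ i / a $ i)"
        have "v + b \<cdot>\<^sub>v a \<in> C" using C v a by (simp add: is_code_def)
        moreover have "(v + b \<cdot>\<^sub>v a) $ i = 0"
          using v a carr i ai by (auto simp: b_def subset_iff)
        ultimately have "hermitian_inner u (v + b \<cdot>\<^sub>v a) = 0" using orth by blast
        moreover have "hermitian_inner u (v + b \<cdot>\<^sub>v a) = hermitian_inner u v + conj4 b * (u $ i)"
          using v a carr rep[OF u] by (subst hermitian_inner_add_smult_right[OF F4]) auto
        ultimately show ?thesis using orth by simp
      qed
      then show "u = 0\<^sub>v n" using lcd u unfolding hermitian_lcd_code_iff[OF C] by blast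
    qed
  qed
qed

theorem corollary4p5:
  fixes C :: "'a::field vec set" and G :: "'a mat" and n k i :: nat
  assumes F4: "card (UNIV :: 'a set) = 4"
    and code: "linear_code n k C"
    and lcd: "hermitian_lcd_code n C"
    and gen: "generator_matrix n k C G"
    and orth: "G * transpose_mat (map_mat conj4 G) = 1\<^sub>m k"
    and i: "i < n"
    and nonzero_column: "col G i \<noteq> 0\<^sub>v k"
  shows "hermitian_lcd_code (n - 1) (shortened_code i C) \<longleftrightarrow> odd (wt (col G i))"
proof -
  have C: "is_code n C" using code linear_code_iff_is_code by blast
  have G: "G \<in> carrier_mat k n" using gen by (simp add: generator_matrix_def)
  obtain a where a: "a \<in> C" and rep: "\<And>c. c \<in> C \<Longrightarrow> hermitian_inner c a = c $ i"
    and ai: "a $ i = of_nat (wt (col G i))"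
    using coordinate_representer[OF F4 C gen orth i] by blast
  \<comment> \<open>If \<open>a\<close> were zero, all codewords, in particular the rows of
    \<open>G\<close>, would vanish at \<open>i\<close>. This excludes the zero column, whose weight
    is even although the shortened code is then LCD.\<close>
  have "a \<noteq> 0\<^sub>v n"
  proof
    assume a0: "a = 0\<^sub>v n"
    have "col G i $ r = 0" if r: "r < k" for r
    proof -
      \<comment> \<open>Encoding a unit vector yields row \<open>r\<close> of \<open>G\<close>,
        whose i-th entry is \<open>col G i $ r\<close>.\<close>
      have "transpose_mat G *\<^sub>v unit_vec k r \<in> C"
        by (auto simp: generator_matrix_codewords[OF C gen])
      then have "(transpose_mat G *\<^sub>v unit_vec k r) $ i = 0"
        using rep by (fastforce simp: a0 hermitian_inner_sum[of _ n])
      then show ?thesis using G i r by simp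
    qed
    then show False using nonzero_column G by (auto intro!: eq_vecI)
  qed
  then show ?thesis
    using representer_nonzero_lcd_shortened[OF F4 C lcd i a _ rep]
    by (simp add: ai F4_of_nat_eq_0_iff[OF F4])
qed

end
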